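(* Let $c:\ \widetilde z(u)=(r(u),0,x_1(u),x_2(u))$, $u\in J$, be a smooth spacelike curve in $\mathbb{R}^4_1$ parameterized by arc-length, i.e. $(r')^2+(x_1')^2-(x_2')^2=1$, with $r(u)>0$ and $\langle t_c'(u),t_c'(u)\rangle=(r'')^2+(x_1'')^2-(x_2'')^2\neq 0$ for $u\in J$, where $t_c=\widetilde z'$. Let $\kappa$ be the curvature of $c$, let $\varepsilon=\langle n_c,n_c\rangle=\pm1$, where $n_c$ is the principal normal of $c$ (so $t_c'=\kappa\,n_c$), and let $\kappa_1=x_1'x_2''-x_2'x_1''$. The spacelike rotational surface of elliptic type $M^2$, defined by $$z(u,v)=\left(r(u)\cos v,r(u)\sin v,x_1(u),x_2(u)\right),\quad u\in J,\ v\in[0;2\pi),$$ is a Chen surface if and only if one of the following cases holds: (i) $\kappa_1=0$ and $r\kappa^2-\varepsilon r''=0$; in such case $M^2$ is a minimal surface (trivial Chen surface); (ii) $\kappa_1=0$ and $r\kappa^2-\varepsilon r''\neq 0$; in such case $M^2$ is a surface lying in a three-dimensional subspace of $\mathbb{R}^4_1$ (trivial Chen surface); (iii) $\kappa_1\neq 0$ and $r^2\kappa^4-(r'')^2+(\kappa_1)^2=0$; in such case $M^2$ is a non-trivial Chen surface in $\mathbb{R}^4_1$.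
   Context: $\mathbb{R}^4_1$ is the four-dimensional Minkowski space with the metric $\langle\,,\rangle=dx_1^2+dx_2^2+dx_3^2-dx_4^2$. A surface is spacelike if the induced metric is Riemannian. The curvature of $c$ is $\kappa=\sqrt{|\langle t_c',t_c'\rangle|}>0$, so $\varepsilon$ is the sign of $\langle t_c',t_c'\rangle$. Let $\sigma$ be the second fundamental tensor of the surface, $H=\frac12\,\mathrm{tr}\,\sigma$ its mean curvature vector field, and $A_\xi$ the shape operator with respect to a normal vector field $\xi$, i.e. $\langle A_\xi X,Y\rangle=\langle\sigma(X,Y),\xi\rangle$. For an $n$-dimensional submanifold of an $(n+m)$-dimensional space, the allied vector field of a normal vector field $\xi$ is $a(\xi)=\frac{\|\xi\|}{n}\sum_{k=2}^m\mathrm{tr}(A_{\xi_1}A_{\xi_k})\,\xi_k$, where $\{\xi_1=\xi/\|\xi\|,\xi_2,\dots,\xi_m\}$ is an orthonormal base of the normal space; for surfaces in $\mathbb{R}^4_1$, $n=m=2$, and for $H$ non-zero spacelike or timelike one takes $\|H\|=\sqrt{|\langle H,H\rangle|}$. A submanifold is a Chen submanifold if its allied mean curvature vector field $a(H)$ vanishes identically. Minimal submanifolds ($H=0$), pseudo-umbilical submanifolds ($\langle\sigma(X,Y),H\rangle=\langle H,H\rangle\langle X,Y\rangle$ for all tangent $X,Y$) and hypersurfaces are Chen submanifolds, and these are called trivial Chen submanifolds; a surface lying in a three-dimensional subspace (hyperplane) of $\mathbb{R}^4_1$ is regarded as a trivial Chen surface. A Chen surface that is not trivial is called non-trivial.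
   Formalization: In (iii), "non-trivial" is proved only as "not minimal and not lying in a hyperplane": every surface of case (iii) is pseudo-umbilical, so the literal claim is false; the "if and only if" is read pointwise in u. *)

theory Defs
  imports "HOL-Analysis.Analysis"
begin

section \<open>Minkowski 4-space\<close>

definition mink :: "real^4 \<Rightarrow> real^4 \<Rightarrow> real" where
  "mink x y = x$1 * y$1 + x$2 * y$2 + x$3 * y$3 - x$4 * y$4"

definition mink_norm :: "real^4 \<Rightarrow> real" where
  "mink_norm x = sqrt \<bar>mink x x\<bar>"

definition smooth_fun_on :: "real set \<Rightarrow> (real \<Rightarrow> real) \<Rightarrow> bool" where
  "smooth_fun_on J f \<longleftrightarrow> (\<forall>n. (deriv ^^ n) f differentiable_on J)"


section \<open>Unit-speed curves\<close>

definition curve_tangent :: "(real \<Rightarrow> real^4) \<Rightarrow> real \<Rightarrow> real^4" where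
  "curve_tangent c u = vector_derivative c (at u)"

definition curve_tangent' :: "(real \<Rightarrow> real^4) \<Rightarrow> real \<Rightarrow> real^4" where
  "curve_tangent' c u = vector_derivative (curve_tangent c) (at u)"

definition curvature :: "(real \<Rightarrow> real^4) \<Rightarrow> real \<Rightarrow> real" where
  "curvature c u = sqrt \<bar>mink (curve_tangent' c u) (curve_tangent' c u)\<bar>"

definition principal_normal :: "(real \<Rightarrow> real^4) \<Rightarrow> real \<Rightarrow> real^4" where
  "principal_normal c u = (1 / curvature c u) *\<^sub>R curve_tangent' c u"


section \<open>Parametrized spacelike surfaces\<close>

text \<open>
  A surface is a map \<open>z\<close> of two real parameters; all geometric objects are taken at the
  point with parameters \<open>(u, v)\<close>.  A tangent vector is represented by its coordinates
  \<open>X :: real^2\<close> in the frame \<open>z\<^sub>u, z\<^sub>v\<close>, so a linear operator on the tangent plane is a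
  matrix \<open>real^2^2\<close>, whose trace does not depend on the frame.
\<close>

type_synonym surface = "real \<Rightarrow> real \<Rightarrow> real^4"

definition partial :: "2 \<Rightarrow> surface \<Rightarrow> surface" where
  "partial i z u v =
     (if i = 1 then vector_derivative (\<lambda>s. z s v) (at u)
      else vector_derivative (\<lambda>s. z u s) (at v))"

definition tangent :: "surface \<Rightarrow> real \<Rightarrow> real \<Rightarrow> real^2 \<Rightarrow> real^4" where
  "tangent z u v X = (\<Sum>i\<in>UNIV. X$i *\<^sub>R partial i z u v)"

definition tangent_space :: "surface \<Rightarrow> real \<Rightarrow> real \<Rightarrow> (real^4) set" where
  "tangent_space z u v = range (tangent z u v)"

definition normal_space :: "surface \<Rightarrow> real \<Rightarrow> real \<Rightarrow> (real^4) set" where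
  "normal_space z u v = {\<xi>. \<forall>w\<in>tangent_space z u v. mink \<xi> w = 0}"

definition normal_part :: "surface \<Rightarrow> real \<Rightarrow> real \<Rightarrow> real^4 \<Rightarrow> real^4" where
  "normal_part z u v w =
     (THE \<nu>. \<nu> \<in> normal_space z u v \<and> w - \<nu> \<in> tangent_space z u v)"

definition first_form :: "surface \<Rightarrow> real \<Rightarrow> real \<Rightarrow> real^2^2" where
  "first_form z u v = (\<chi> i j. mink (partial i z u v) (partial j z u v))"

text \<open>Second fundamental tensor \<open>\<sigma>(X, Y)\<close>: Gauss formula for the flat ambient connection.\<close>

definition second_form :: "surface \<Rightarrow> real \<Rightarrow> real \<Rightarrow> real^2 \<Rightarrow> real^2 \<Rightarrow> real^4" where
  "second_form z u v X Y =
     normal_part z u v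
       (\<Sum>i\<in>UNIV. \<Sum>j\<in>UNIV. (X$i * Y$j) *\<^sub>R partial i (partial j z) u v)"

text \<open>The trace of \<open>\<sigma>\<close> is the metric one, \<open>tr \<sigma> = g\<^sup>i\<^sup>j \<sigma>\<^sub>i\<^sub>j\<close>.\<close>

definition mean_curvature :: "surface \<Rightarrow> real \<Rightarrow> real \<Rightarrow> real^4" where
  "mean_curvature z u v =
     (1/2) *\<^sub>R (\<Sum>i\<in>UNIV. \<Sum>j\<in>UNIV.
        (matrix_inv (first_form z u v) $ i $ j) *\<^sub>R second_form z u v (axis i 1) (axis j 1))"

definition shape_operator :: "surface \<Rightarrow> real \<Rightarrow> real \<Rightarrow> real^4 \<Rightarrow> real^2^2" where
  "shape_operator z u v \<xi> =
     (THE A. \<forall>X Y. mink (tangent z u v (A *v X)) (tangent z u v Y)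
                   = mink (second_form z u v X Y) \<xi>)"

definition orthonormal_normal_base ::
    "surface \<Rightarrow> real \<Rightarrow> real \<Rightarrow> real^4 \<Rightarrow> real^4 \<Rightarrow> bool" where
  "orthonormal_normal_base z u v \<xi>1 \<xi>2 \<longleftrightarrow>
     \<bar>mink \<xi>1 \<xi>1\<bar> = 1 \<and> \<bar>mink \<xi>2 \<xi>2\<bar> = 1 \<and> mink \<xi>1 \<xi>2 = 0 \<and>
     span {\<xi>1, \<xi>2} = normal_space z u v"

text \<open>
  Allied vector field of a normal vector \<open>\<xi>\<close> with \<open>mink \<xi> \<xi> \<noteq> 0\<close>, for \<open>n = m = 2\<close>.  The vector
  \<open>\<xi>\<^sub>2\<close> is determined up to sign, so the value does not depend on the choice.
\<close>

definition allied :: "surface \<Rightarrow> real \<Rightarrow> real \<Rightarrow> real^4 \<Rightarrow> real^4" where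
  "allied z u v \<xi> =
     (let \<xi>1 = (1 / mink_norm \<xi>) *\<^sub>R \<xi>;
          \<xi>2 = (SOME \<eta>. orthonormal_normal_base z u v \<xi>1 \<eta>)
      in (mink_norm \<xi> / 2 * trace (shape_operator z u v \<xi>1 ** shape_operator z u v \<xi>2)) *\<^sub>R \<xi>2)"

text \<open>
  At a point where \<open>H\<close> is lightlike and non-zero there is no unit vector along \<open>H\<close> and
  \<open>a(H)\<close> is undefined; such a point is not admitted on a Chen surface.  Where \<open>H = 0\<close>,
  \<open>a(H) = 0\<close>.
\<close>

definition Chen_surface :: "surface \<Rightarrow> (real \<times> real) set \<Rightarrow> bool" where
  "Chen_surface z D \<longleftrightarrow>
     (\<forall>(u, v)\<in>D. let H = mean_curvature z u v in
        H = 0 \<or> (mink H H \<noteq> 0 \<and> allied z u v H = 0))"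

definition minimal_surface :: "surface \<Rightarrow> (real \<times> real) set \<Rightarrow> bool" where
  "minimal_surface z D \<longleftrightarrow> (\<forall>(u, v)\<in>D. mean_curvature z u v = 0)"

definition pseudo_umbilical :: "surface \<Rightarrow> (real \<times> real) set \<Rightarrow> bool" where
  "pseudo_umbilical z D \<longleftrightarrow>
     (\<forall>(u, v)\<in>D. let H = mean_curvature z u v in
        \<forall>X Y. mink (second_form z u v X Y) H
               = mink H H * mink (tangent z u v X) (tangent z u v Y))"

text \<open>The three-dimensional subspace is affine: it need not contain the origin.\<close>

definition lies_in_hyperplane :: "surface \<Rightarrow> (real \<times> real) set \<Rightarrow> bool" where
  "lies_in_hyperplane z D \<longleftrightarrow>
     (\<exists>S. affine S \<and> aff_dim S = 3 \<and> (\<forall>(u, v)\<in>D. z u v \<in> S))"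

text \<open>
  The elliptic rotational surfaces with \<open>r\<^sup>2 \<kappa>\<^sup>4 - (r'')\<^sup>2 + (\<kappa>\<^sub>1)\<^sup>2 = 0\<close> are all
  pseudo-umbilical, hence trivial in the sense below, even when \<open>\<kappa>\<^sub>1 \<noteq> 0\<close>.  Their
  non-triviality can only be meant with respect to the other two classes: they are neither
  minimal nor contained in a hyperplane.
\<close>

definition trivial_Chen_surface :: "surface \<Rightarrow> (real \<times> real) set \<Rightarrow> bool" where
  "trivial_Chen_surface z D \<longleftrightarrow>
     Chen_surface z D \<and> (minimal_surface z D \<or> pseudo_umbilical z D \<or> lies_in_hyperplane z D)"


section \<open>Rotational surfaces of elliptic type\<close>

definition meridian :: "(real \<Rightarrow> real) \<Rightarrow> (real \<Rightarrow> real) \<Rightarrow> (real \<Rightarrow> real) \<Rightarrow> real \<Rightarrow> real^4" where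
  "meridian r x1 x2 u = vector [r u, 0, x1 u, x2 u]"

definition elliptic_rotational_surface ::
    "(real \<Rightarrow> real) \<Rightarrow> (real \<Rightarrow> real) \<Rightarrow> (real \<Rightarrow> real) \<Rightarrow> surface" where
  "elliptic_rotational_surface r x1 x2 u v =
     vector [r u * cos v, r u * sin v, x1 u, x2 u]"

end

theory Submission
  imports Defs
begin

text \<open>
  In the coordinates \<open>(u, v)\<close> the surface has \<open>E = 1\<close>, \<open>F = 0\<close>, \<open>G = r\<^sup>2\<close> and \<open>\<sigma>\<^sub>1\<^sub>2 = 0\<close>.  With
  \<open>L = \<sigma>\<^sub>1\<^sub>1 / E\<close> and \<open>K = \<sigma>\<^sub>2\<^sub>2 / G\<close> one has \<open>H = (L + K) / 2\<close> and \<open>A\<^sub>\<xi> = diag (\<langle>L, \<xi>\<rangle>, \<langle>K, \<xi>\<rangle>)\<close>.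
  If \<open>\<xi>\<^sub>2\<close> is orthogonal to \<open>H\<close>, then \<open>\<langle>K, \<xi>\<^sub>2\<rangle> = - \<langle>L, \<xi>\<^sub>2\<rangle>\<close>, so the trace in \<open>a(H)\<close> is proportional to
  \<open>\<langle>L, \<xi>\<^sub>2\<rangle> (\<langle>L, L\<rangle> - \<langle>K, K\<rangle>)\<close>; hence \<open>a(H) = 0\<close> iff \<open>L\<close> and \<open>K\<close> are parallel or have the same
  square.  Writing \<open>q = \<langle>t', t'\<rangle> = \<epsilon> \<kappa>\<^sup>2\<close>, the Gram determinant of \<open>L, K\<close> is \<open>- \<kappa>1\<^sup>2 / r\<^sup>2\<close>, and
  \<open>\<langle>L, L\<rangle> = q\<close>, \<open>\<langle>K, K\<rangle> = (1 - r'\<^sup>2) / r\<^sup>2\<close>, \<open>\<langle>L, K\<rangle> = - r'' / r\<close>; the second alternative becomes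
  \<open>r\<^sup>2 \<kappa>\<^sup>4 - r''\<^sup>2 + \<kappa>1\<^sup>2 = 0\<close>.
\<close>

section \<open>Minkowski geometry\<close>

lemma vector_4_nth [simp]:
  "(vector [a, b, c, d] :: 'a::zero^4) $ 1 = a"
  "(vector [a, b, c, d] :: 'a::zero^4) $ 2 = b"
  "(vector [a, b, c, d] :: 'a::zero^4) $ 3 = c"
  "(vector [a, b, c, d] :: 'a::zero^4) $ 4 = d"
  unfolding vector_def by simp_all

lemma mink_commute: "mink x y = mink y x"
  by (simp add: mink_def)

lemma mink_linear [simp]:
  "mink (x + y) z = mink x z + mink y z" "mink z (x + y) = mink z x + mink z y"
  "mink (x - y) z = mink x z - mink y z" "mink z (x - y) = mink z x - mink z y"
  "mink (k *\<^sub>R x) z = k * mink x z" "mink z (k *\<^sub>R x) = k * mink z x"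
  "mink 0 z = 0" "mink z 0 = 0"
  by (simp_all add: mink_def algebra_simps)

text \<open>Changing the sign of the fourth coordinate turns Euclidean orthogonality into Minkowski
  orthogonality, which carries facts on Euclidean hyperplanes over to \<open>mink\<close>.\<close>

lemma mink_inner:
  fixes a y :: "real^4"
  shows "mink (vector [a$1, a$2, a$3, - a$4]) y = a \<bullet> y"
  by (simp add: mink_def inner_vec_def sum_4)

lemma mink_nondegenerate:
  assumes "\<And>y. mink x y = 0" shows "x = 0"
proof -
  have "x $ i = 0" for i
    using assms[of "axis 1 1"] assms[of "axis 2 1"] assms[of "axis 3 1"] assms[of "axis 4 1"]
      exhaust_4[of i]
    by (auto simp: mink_def axis_def)
  then show ?thesis by (simp add: vec_eq_iff)
qed

lemma mink_span_eq_0: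
  assumes "\<And>s. s \<in> S \<Longrightarrow> mink s x = 0" "y \<in> span S"
  shows "mink y x = 0"
  using assms(2) by (induction rule: span_induct_alt) (auto simp: assms(1))

text \<open>Three vectors span a proper subspace, so a Euclidean hyperplane through the origin
  contains them; its normal, with the last sign flipped, is the vector sought.\<close>

lemma mink_orthogonal_exists:
  fixes a b c :: "real^4"
  obtains x where "x \<noteq> 0" "mink x a = 0" "mink x b = 0" "mink x c = 0"
proof -
  have "dim {a, b, c} \<le> card {a, b, c}" by (rule dim_le_card') simp
  also have "\<dots> \<le> 3" by (simp add: card_insert_if)
  finally have "dim {a, b, c} < DIM(real^4)" by simp
  then obtain n :: "real^4" where n: "n \<noteq> 0" "span {a, b, c} \<subseteq> {y. n \<bullet> y = 0}"
    using lowdim_subset_hyperplane by blast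
  let ?x = "vector [n$1, n$2, n$3, - n$4] :: real^4"
  have "?x \<noteq> 0" using n(1) by (auto simp: vec_eq_iff forall_4)
  moreover have "mink ?x y = 0" if "y \<in> {a, b, c}" for y
    using n(2) span_base[OF that] by (auto simp: mink_inner)
  ultimately show ?thesis using that by blast
qed

text \<open>Pairing a linear relation with \<open>a\<close>, \<open>b\<close>, \<open>c\<close>
  isolates its coefficients, so the four vectors are independent. The vector \<open>x\<close> may be
  null here; the next lemma excludes that case.\<close>

lemma span_mink_orthogonal:
  assumes nonnull: "mink a a \<noteq> 0" "mink b b \<noteq> 0" "mink c c \<noteq> 0"
    and orth: "mink a b = 0" "mink a c = 0" "mink b c = 0"
    and x: "x \<noteq> 0" "mink x a = 0" "mink x b = 0" "mink x c = 0"
  shows "span {x, a, b, c} = UNIV"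
proof -
  note comm = mink_commute[of b a] mink_commute[of c a] mink_commute[of c b]
  have c: "c \<noteq> 0" using nonnull by auto
  have b: "b \<notin> span {c}"
    using mink_span_eq_0[of "{c}" b b] nonnull orth comm by auto
  have a: "a \<notin> span {b, c}"
    using mink_span_eq_0[of "{b, c}" a a] nonnull orth comm by auto
  have "x \<notin> span {a, b, c}"
  proof
    assume "x \<in> span {a, b, c}"
    then obtain l m k where eq: "x = l *\<^sub>R a + m *\<^sub>R b + k *\<^sub>R c"
      by (auto simp: span_breakdown_eq algebra_simps)
    have "mink x a = l * mink a a" "mink x b = m * mink b b" "mink x c = k * mink c c"
      using orth comm by (simp_all add: eq)
    then have "l = 0" "m = 0" "k = 0" using x nonnull by auto
    then show False using eq x(1) by simp
  qed
  then have ind: "independent {x, a, b, c}"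
    using a b c by (simp add: independent_insert span_base)
  have "x \<noteq> a" "x \<noteq> b" "x \<noteq> c" "a \<noteq> b" "a \<noteq> c" "b \<noteq> c"
    using nonnull orth x by auto
  then have "card {x, a, b, c} = 4" by simp
  then have "dim {x, a, b, c} = DIM(real^4)"
    using dim_eq_card_independent[OF ind] by simp
  then show ?thesis using dim_eq_full by blast
qed

text \<open>A nonzero null \<open>x\<close> would be orthogonal to a whole basis, itself included,
  against nondegeneracy.\<close>

lemma mink_orthogonal_complement_trivial:
  assumes "mink a a \<noteq> 0" "mink b b \<noteq> 0" "mink c c \<noteq> 0"
    and "mink a b = 0" "mink a c = 0" "mink b c = 0"
    and "mink x x = 0" "mink x a = 0" "mink x b = 0" "mink x c = 0"
  shows "x = 0"
proof (rule ccontr)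
  assume "x \<noteq> 0"
  then have span: "span {x, a, b, c} = UNIV"
    using assms by (intro span_mink_orthogonal)
  have "mink x y = 0" for y
    unfolding mink_commute[of x y]
    by (rule mink_span_eq_0[of "{x, a, b, c}"]) (use assms span in \<open>auto simp: mink_commute\<close>)
  with \<open>x \<noteq> 0\<close> mink_nondegenerate show False by blast
qed

section \<open>Orthogonal conjugate parametrizations\<close>

text \<open>Tangency of the mixed derivatives says that the coordinate directions are conjugate.
  Both orders are listed because \<open>second_form\<close> sums over both.\<close>

locale orthogonal_conjugate =
  fixes z :: surface and u v :: real
  assumes E_pos: "0 < mink (partial 1 z u v) (partial 1 z u v)"
    and G_pos: "0 < mink (partial 2 z u v) (partial 2 z u v)"
    and F_0: "mink (partial 1 z u v) (partial 2 z u v) = 0"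
    and mixed_tangent: "partial 1 (partial 2 z) u v \<in> tangent_space z u v"
      "partial 2 (partial 1 z) u v \<in> tangent_space z u v"
begin

abbreviation "P \<equiv> partial 1 z u v"
abbreviation "Q \<equiv> partial 2 z u v"

text \<open>\<open>L\<close> and \<open>K\<close> are the values of the second fundamental tensor on
  the unit vectors along the two coordinate lines.\<close>

definition "L = (1 / mink P P) *\<^sub>R normal_part z u v (partial 1 (partial 1 z) u v)"
definition "K = (1 / mink Q Q) *\<^sub>R normal_part z u v (partial 2 (partial 2 z) u v)"

lemma F_0': "mink Q P = 0"
  using F_0 by (simp add: mink_commute)

lemma tangent_eq: "tangent z u v X = X$1 *\<^sub>R P + X$2 *\<^sub>R Q"
  by (simp add: tangent_def sum_2)

lemma tangent_space_iff: "w \<in> tangent_space z u v \<longleftrightarrow> (\<exists>s t. w = s *\<^sub>R P + t *\<^sub>R Q)"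
proof
  assume "\<exists>s t. w = s *\<^sub>R P + t *\<^sub>R Q"
  then obtain s t where "w = s *\<^sub>R P + t *\<^sub>R Q" by blast
  then have "w = tangent z u v (vector [s, t])" by (simp add: tangent_eq)
  then show "w \<in> tangent_space z u v" unfolding tangent_space_def by blast
qed (auto simp: tangent_space_def tangent_eq)

lemma normal_space_iff: "\<xi> \<in> normal_space z u v \<longleftrightarrow> mink \<xi> P = 0 \<and> mink \<xi> Q = 0"
proof
  assume \<xi>: "\<xi> \<in> normal_space z u v"
  have "tangent z u v (axis 1 1) = P" "tangent z u v (axis 2 1) = Q"
    by (simp_all add: tangent_eq axis_def)
  then have "P \<in> tangent_space z u v" "Q \<in> tangent_space z u v"
    unfolding tangent_space_def by (metis rangeI)+
  then show "mink \<xi> P = 0 \<and> mink \<xi> Q = 0" using \<xi> by (auto simp: normal_space_def)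
qed (auto simp: normal_space_def tangent_space_iff)

text \<open>Two candidates for the \<open>THE\<close> differ by a vector that is both tangent and
  normal; orthogonality of the frame and positivity of its squares make the coefficients of this
  vector zero.\<close>

lemma normal_part_eqI:
  assumes "\<nu> \<in> normal_space z u v" "w - \<nu> \<in> tangent_space z u v"
  shows "normal_part z u v w = \<nu>"
  unfolding normal_part_def
proof (rule the_equality)
  fix \<mu> assume \<mu>: "\<mu> \<in> normal_space z u v \<and> w - \<mu> \<in> tangent_space z u v"
  obtain s t s' t' where eqs: "w - \<nu> = s *\<^sub>R P + t *\<^sub>R Q" "w - \<mu> = s' *\<^sub>R P + t' *\<^sub>R Q"
    using assms \<mu> by (auto simp: tangent_space_iff)
  then have eq: "\<mu> - \<nu> = (s - s') *\<^sub>R P + (t - t') *\<^sub>R Q" by (simp add: algebra_simps)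
  have "mink (\<mu> - \<nu>) P = 0" "mink (\<mu> - \<nu>) Q = 0"
    using assms \<mu> by (auto simp: normal_space_iff)
  then have "s = s'" "t = t'" unfolding eq using F_0 F_0' E_pos G_pos by auto
  with eq show "\<mu> = \<nu>" by simp
qed (use assms in simp)

lemma normal_part_eq:
  "normal_part z u v w = w - (mink w P / mink P P) *\<^sub>R P - (mink w Q / mink Q Q) *\<^sub>R Q"
proof (rule normal_part_eqI)
  show "w - (mink w P / mink P P) *\<^sub>R P - (mink w Q / mink Q Q) *\<^sub>R Q \<in> normal_space z u v"
    using E_pos G_pos F_0 F_0' by (simp add: normal_space_iff)
  show "w - (w - (mink w P / mink P P) *\<^sub>R P - (mink w Q / mink Q Q) *\<^sub>R Q)
      \<in> tangent_space z u v"
    unfolding tangent_space_iff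
    by (intro exI[of _ "mink w P / mink P P"] exI[of _ "mink w Q / mink Q Q"]) simp
qed

lemma normal_part_tangent:
  assumes "w \<in> tangent_space z u v" shows "normal_part z u v w = 0"
  using assms by (intro normal_part_eqI) (auto simp: normal_space_iff)

lemma normal_part_add:
  "normal_part z u v (w + w') = normal_part z u v w + normal_part z u v w'"
  by (simp add: normal_part_eq add_divide_distrib algebra_simps)

lemma normal_part_scaleR: "normal_part z u v (k *\<^sub>R w) = k *\<^sub>R normal_part z u v w"
  by (simp add: normal_part_eq algebra_simps)

lemma L_K_normal: "mink L P = 0" "mink L Q = 0" "mink K P = 0" "mink K Q = 0"
  using E_pos G_pos F_0 F_0' by (simp_all add: L_def K_def normal_part_eq)

text \<open>The mixed terms are tangent and drop out; the metric coefficients undo the normalisation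
  in \<open>L\<close> and \<open>K\<close>.\<close>

lemma second_form_eq:
  "second_form z u v X Y = (X$1 * Y$1 * mink P P) *\<^sub>R L + (X$2 * Y$2 * mink Q Q) *\<^sub>R K"
  using E_pos G_pos
  by (simp add: second_form_def sum_2 normal_part_add normal_part_scaleR
      normal_part_tangent[OF mixed_tangent(1)] normal_part_tangent[OF mixed_tangent(2)]
      L_def K_def)

text \<open>\<open>matrix_inv\<close> is defined by choice, so uniqueness of a two-sided inverse is
  what identifies it with the explicit diagonal matrix.\<close>

lemma matrix_inv_first_form:
  "matrix_inv (first_form z u v) = vector [vector [1 / mink P P, 0], vector [0, 1 / mink Q Q]]"
    (is "_ = ?B")
proof -
  have inv: "first_form z u v ** ?B = mat 1" "?B ** first_form z u v = mat 1"
    using E_pos G_pos F_0 F_0'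
    by (simp_all add: vec_eq_iff forall_2 matrix_matrix_mult_def sum_2 first_form_def mat_def)
  then show ?thesis
    unfolding matrix_inv_def
  proof (intro some_equality conjI)
    fix A assume A: "first_form z u v ** A = mat 1 \<and> A ** first_form z u v = mat 1"
    have "A = A ** (first_form z u v ** ?B)" using inv by simp
    also have "\<dots> = ?B" using A by (simp add: matrix_mul_assoc)
    finally show "A = ?B" .
  qed
qed

lemma mean_curvature_eq: "mean_curvature z u v = (1/2) *\<^sub>R (L + K)"
  using E_pos G_pos
  by (simp add: mean_curvature_def matrix_inv_first_form sum_2 second_form_eq axis_def)

lemma shape_operator_eq:
  "shape_operator z u v \<xi> = vector [vector [mink L \<xi>, 0], vector [0, mink K \<xi>]]"
    (is "_ = ?B")
  unfolding shape_operator_def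
proof (rule the_equality)
  show "\<forall>X Y. mink (tangent z u v (?B *v X)) (tangent z u v Y) = mink (second_form z u v X Y) \<xi>"
    using F_0 F_0'
    by (simp add: tangent_eq second_form_eq matrix_vector_mult_def sum_2 algebra_simps)
next
  fix A assume A: "\<forall>X Y. mink (tangent z u v (A *v X)) (tangent z u v Y)
      = mink (second_form z u v X Y) \<xi>"
  \<comment> \<open>Pairing the image of the \<open>j\<close>-th frame vector with the
    \<open>i\<close>-th one gives the entry \<open>A $ i $ j\<close> times a positive metric
    coefficient.\<close>
  have "A $ i $ j = ?B $ i $ j" for i j
    using A[rule_format, of "axis j 1" "axis i 1"] E_pos G_pos F_0 F_0' exhaust_2[of i]
      exhaust_2[of j]
    by (auto simp: tangent_eq second_form_eq matrix_vector_mult_def sum_2 axis_def)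
  then show "A = ?B" by (simp add: vec_eq_iff)
qed

text \<open>Guarantees that the \<open>SOME\<close> in \<open>allied\<close> has a witness. A vector
  orthogonal to \<open>P\<close>, \<open>Q\<close> and \<xi> exists by dimension, and it is non-null
  by the complement lemma, so it can be normalised.\<close>

lemma normal_basis_exists:
  assumes \<xi>: "\<xi> \<in> normal_space z u v" "\<bar>mink \<xi> \<xi>\<bar> = 1"
  obtains \<eta> where "orthonormal_normal_base z u v \<xi> \<eta>"
proof -
  have \<xi>0: "mink \<xi> \<xi> \<noteq> 0" and \<xi>P: "mink \<xi> P = 0" "mink \<xi> Q = 0" "mink P \<xi> = 0" "mink Q \<xi> = 0"
    using \<xi> by (auto simp: normal_space_iff mink_commute)
  obtain x where x: "x \<noteq> 0" "mink x P = 0" "mink x Q = 0" "mink x \<xi> = 0"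
    by (rule mink_orthogonal_exists)
  have xx: "mink x x \<noteq> 0"
    using mink_orthogonal_complement_trivial[of P Q \<xi> x] x \<xi>0 \<xi>P E_pos G_pos F_0 by auto
  define \<eta> where "\<eta> = (1 / mink_norm x) *\<^sub>R x"
  have n: "mink_norm x * mink_norm x = \<bar>mink x x\<bar>" "mink_norm x \<noteq> 0"
    using xx by (simp_all add: mink_norm_def)
  have "mink \<eta> \<eta> = mink x x / (mink_norm x * mink_norm x)"
    by (simp add: \<eta>_def)
  then have \<eta>\<eta>: "\<bar>mink \<eta> \<eta>\<bar> = 1" using xx by (simp add: n)
  have \<eta>: "mink \<eta> P = 0" "mink \<eta> Q = 0" "mink \<eta> \<xi> = 0" "mink \<xi> \<eta> = 0"
    using x by (simp_all add: \<eta>_def mink_commute)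
  have "span {\<xi>, \<eta>} = normal_space z u v"
  proof (intro equalityI subsetI)
    fix y assume "y \<in> span {\<xi>, \<eta>}"
    then have "mink y P = 0" "mink y Q = 0"
      using mink_span_eq_0[of "{\<xi>, \<eta>}" P y] mink_span_eq_0[of "{\<xi>, \<eta>}" Q y] \<eta> \<xi>P by blast+
    then show "y \<in> normal_space z u v" by (simp add: normal_space_iff)
  next
    fix y assume y: "y \<in> normal_space z u v"
    define d where "d = y - (mink y \<xi> / mink \<xi> \<xi>) *\<^sub>R \<xi> - (mink y \<eta> / mink \<eta> \<eta>) *\<^sub>R \<eta>"
    have d: "mink d P = 0" "mink d Q = 0" "mink d \<xi> = 0" "mink d \<eta> = 0"
      using y \<eta> \<xi>P \<xi>0 \<eta>\<eta> by (auto simp: d_def normal_space_iff)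
    \<comment> \<open>Since this frame spans the whole space, the remainder \<open>d\<close>,
      orthogonal to all four vectors, is zero.\<close>
    have span: "span {\<eta>, P, Q, \<xi>} = UNIV"
      using \<eta>\<eta> \<eta> \<xi>P \<xi>0 E_pos G_pos F_0 by (intro span_mink_orthogonal) auto
    have "mink d w = 0" for w
      unfolding mink_commute[of d w]
      by (rule mink_span_eq_0[of "{\<eta>, P, Q, \<xi>}"]) (use d span in \<open>auto simp: mink_commute\<close>)
    then have "d = 0" by (rule mink_nondegenerate)
    then have "y = (mink y \<xi> / mink \<xi> \<xi>) *\<^sub>R \<xi> + (mink y \<eta> / mink \<eta> \<eta>) *\<^sub>R \<eta>"
      by (simp add: d_def algebra_simps)
    then show "y \<in> span {\<xi>, \<eta>}"
      by (metis span_add span_base span_scale insertI1 insertI2)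
  qed
  then have "orthonormal_normal_base z u v \<xi> \<eta>"
    using \<xi> \<eta> \<eta>\<eta> by (simp add: orthonormal_normal_base_def)
  then show ?thesis by (rule that)
qed

section \<open>The allied mean curvature vector and the Gram determinant\<close>

definition "gram = mink L L * mink K K - (mink L K)\<^sup>2"

text \<open>The component \<open>d\<close> of \<open>K\<close> orthogonal to \<open>L\<close> has
  square \<open>gram / mink L L\<close>. It is therefore null, and being orthogonal to
  \<open>P\<close>, \<open>Q\<close>, \<open>L\<close> it vanishes.\<close>

lemma K_parallel_L:
  assumes "mink L L \<noteq> 0" "gram = 0"
  shows "K = (mink L K / mink L L) *\<^sub>R L"
proof -
  define d where "d = K - (mink L K / mink L L) *\<^sub>R L"
  have "mink d L = 0" "mink d P = 0" "mink d Q = 0"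
    using assms(1) L_K_normal by (simp_all add: d_def mink_commute)
  moreover have "mink d d * mink L L = 0"
    using assms by (simp add: d_def gram_def mink_commute[of K L] field_simps power2_eq_square)
  ultimately have "d = 0"
    using mink_orthogonal_complement_trivial[of P Q L d] assms(1) L_K_normal E_pos G_pos F_0
    by (auto simp: mink_commute)
  then show ?thesis by (simp add: d_def)
qed

lemma mean_curvature_eq_0_imp_gram:
  "mean_curvature z u v = 0 \<Longrightarrow> gram = 0"
proof -
  assume "mean_curvature z u v = 0"
  then have K: "K = (-1) *\<^sub>R L" by (simp add: mean_curvature_eq add_eq_0_iff)
  show "gram = 0" unfolding gram_def K mink_linear by (simp add: power2_eq_square)
qed

lemma allied_mean_curvature_eq_0_iff:
  assumes H: "H = mean_curvature z u v" "mink H H \<noteq> 0"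
  shows "allied z u v H = 0 \<longleftrightarrow> gram = 0 \<or> mink L L = mink K K"
proof -
  define m where "m = mink_norm H"
  have m: "m * m = \<bar>mink H H\<bar>" "m > 0" using H(2) by (simp_all add: m_def mink_norm_def)
  define \<xi> where "\<xi> = (1 / m) *\<^sub>R H"
  define \<eta> where "\<eta> = (SOME \<eta>. orthonormal_normal_base z u v \<xi> \<eta>)"
  have "\<xi> \<in> normal_space z u v"
    using L_K_normal by (simp add: \<xi>_def H(1) mean_curvature_eq normal_space_iff)
  moreover have "mink \<xi> \<xi> = mink H H / (m * m)" by (simp add: \<xi>_def)
  then have "\<bar>mink \<xi> \<xi>\<bar> = 1" using H(2) by (simp add: m(1))
  ultimately obtain \<zeta> where "orthonormal_normal_base z u v \<xi> \<zeta>"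
    by (rule normal_basis_exists)
  then have base: "orthonormal_normal_base z u v \<xi> \<eta>"
    unfolding \<eta>_def by (rule someI)
  then have \<eta>\<eta>: "mink \<eta> \<eta> \<noteq> 0" and \<xi>\<eta>: "mink \<xi> \<eta> = 0" and sp: "span {\<xi>, \<eta>} = normal_space z u v"
    by (auto simp: orthonormal_normal_base_def)
  have H\<eta>: "mink H \<eta> = 0" using \<xi>\<eta> m by (simp add: \<xi>_def)
  have LK: "L + K = 2 *\<^sub>R H" by (simp add: H(1) mean_curvature_eq)
  have "mink (L + K) \<eta> = 0" using H\<eta> by (simp add: LK)
  then have K\<eta>: "mink K \<eta> = - mink L \<eta>" by simp
  \<comment> \<open>\<xi> is \<open>L + K\<close> divided by \<open>2 * m\<close>, so pairing it
    with \<open>L - K\<close> leaves a difference of squares.\<close>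
  have L\<xi>: "mink L \<xi> - mink K \<xi> = (mink L L - mink K K) / (2 * m)"
    using m by (simp add: \<xi>_def H(1) mean_curvature_eq mink_commute[of K L] field_simps)
  have \<eta>0: "\<eta> \<noteq> 0" using \<eta>\<eta> by auto
  have "L \<in> span {\<xi>, \<eta>}" using L_K_normal sp by (simp add: normal_space_iff)
  then obtain s \<beta> where "L - s *\<^sub>R \<xi> = \<beta> *\<^sub>R \<eta>"
    by (auto simp: span_breakdown_eq)
  then have L: "L = (s / m) *\<^sub>R H + \<beta> *\<^sub>R \<eta>"
    by (simp add: \<xi>_def algebra_simps)
  have K: "K = 2 *\<^sub>R H - L" using LK by (simp add: algebra_simps)
  \<comment> \<open>The Gram determinant of \<open>L\<close> and \<open>2 *\<^sub>R H - L\<close> is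
    four times that of \<open>L\<close> and \<open>H\<close>, to which only the \<eta>-component of
    \<open>L\<close> contributes.\<close>
  have gram: "gram = 4 * \<beta>\<^sup>2 * mink \<eta> \<eta> * mink H H"
    unfolding gram_def K unfolding L
    using H\<eta> by (simp add: mink_commute[of \<eta> H] power2_eq_square algebra_simps)
  have "mink L \<eta> = \<beta> * mink \<eta> \<eta>" using H\<eta> by (simp add: L)
  then have "mink L \<eta> = 0 \<longleftrightarrow> gram = 0" using gram \<eta>\<eta> H(2) by auto
  moreover have "allied z u v H
      = (m / 2 * (mink L \<xi> * mink L \<eta> + mink K \<xi> * mink K \<eta>)) *\<^sub>R \<eta>"
    by (simp add: allied_def Let_def m_def[symmetric] \<xi>_def[symmetric] \<eta>_def[symmetric]
        shape_operator_eq trace_def sum_2 matrix_matrix_mult_def)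
  moreover have "mink L \<xi> * mink L \<eta> + mink K \<xi> * mink K \<eta>
      = mink L \<eta> * ((mink L L - mink K K) / (2 * m))"
    unfolding L\<xi>[symmetric] K\<eta> by (simp add: algebra_simps)
  ultimately show ?thesis using \<eta>0 m(2) by auto
qed

text \<open>What remains is to exclude a nonzero lightlike \<open>H\<close>. If \<open>H\<close> is
  null, equality of the squares forces \<open>mink L K = - mink L L\<close>, so \<open>gram\<close>
  vanishes in either case. Then \<open>K = t *\<^sub>R L\<close>, and nullity of \<open>H\<close>
  gives \<open>t = -1\<close>, that is \<open>H = 0\<close>.\<close>

lemma Chen_condition_iff:
  assumes L: "mink L L \<noteq> 0" and H: "H = mean_curvature z u v"
  shows "H = 0 \<or> (mink H H \<noteq> 0 \<and> allied z u v H = 0) \<longleftrightarrow> gram = 0 \<or> mink L L = mink K K"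
    (is "?chen \<longleftrightarrow> ?eqs")
proof
  assume ?chen
  then show ?eqs
    using mean_curvature_eq_0_imp_gram allied_mean_curvature_eq_0_iff[OF H] H by auto
next
  assume eqs: ?eqs
  have "H = 0" if HH: "mink H H = 0"
  proof -
    have sq: "mink L L + mink K K + 2 * mink L K = 0"
      using HH by (simp add: H mean_curvature_eq mink_commute[of K L] field_simps)
    have g: "gram = 0"
    proof (cases "mink L L = mink K K")
      case True
      then have "mink L K = - mink L L" using sq by simp
      with True show ?thesis by (simp add: gram_def power2_eq_square)
    qed (use eqs in simp)
    define t where "t = mink L K / mink L L"
    have K: "K = t *\<^sub>R L" using K_parallel_L[OF L g] by (simp add: t_def)
    have "mink L L * (1 + t)\<^sup>2 = 0"
      using sq unfolding K by (simp add: power2_eq_square algebra_simps)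
    then have "t = -1" using L by auto
    then show ?thesis by (simp add: H mean_curvature_eq K)
  qed
  then show ?chen using eqs allied_mean_curvature_eq_0_iff[OF H] by blast
qed

lemma mean_curvature_eq_0:
  assumes "mink L L \<noteq> 0" "gram = 0" "mink L K = - mink L L"
  shows "mean_curvature z u v = 0"
  using K_parallel_L[OF assms(1,2)] assms(1,3) by (simp add: mean_curvature_eq)

end

section \<open>Differentiation of curves in 4-space\<close>

lemma smooth_fun_on_deriv:
  assumes "smooth_fun_on J f" shows "smooth_fun_on J (deriv f)"
  unfolding smooth_fun_on_def
proof
  fix n
  show "(deriv ^^ n) (deriv f) differentiable_on J"
    using assms[unfolded smooth_fun_on_def, rule_format, of "Suc n"]
    by (simp add: funpow_swap1)
qed

lemma smooth_fun_on_has_derivative: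
  assumes "smooth_fun_on J f" "open J" "u \<in> J"
  shows "(f has_real_derivative deriv f u) (at u)"
proof -
  have "f differentiable_on J" using assms(1)[unfolded smooth_fun_on_def, rule_format, of 0] by simp
  then have "f differentiable (at u)"
    using assms(2,3) by (simp add: differentiable_on_eq_differentiable_at)
  then show ?thesis by (simp add: DERIV_deriv_iff_real_differentiable)
qed

lemma has_derivative_const_on_open:
  fixes f :: "real \<Rightarrow> real"
  assumes "(f has_real_derivative d) (at u)" "open J" "u \<in> J" "\<And>t. t \<in> J \<Longrightarrow> f t = c"
  shows "d = 0"
proof -
  have "((\<lambda>_. c) has_real_derivative d) (at u)"
    using has_field_derivative_transform_within_open[OF assms(1-3)] assms(4) by auto
  then show ?thesis using DERIV_const DERIV_unique by blast
qed

text \<open>The proportionality hypothesis makes the derivative of \<open>g / f\<close> zero. It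
  serves below to show that a planar vector field has constant direction.\<close>

lemma ratio_constant:
  fixes f g f' g' :: "real \<Rightarrow> real"
  assumes "is_interval J"
    and "\<And>u. u \<in> J \<Longrightarrow> (f has_real_derivative f' u) (at u)"
    and "\<And>u. u \<in> J \<Longrightarrow> (g has_real_derivative g' u) (at u)"
    and "\<And>u. u \<in> J \<Longrightarrow> f u * g' u = g u * f' u" "\<And>u. u \<in> J \<Longrightarrow> f u \<noteq> 0"
  obtains m where "\<And>u. u \<in> J \<Longrightarrow> g u = m * f u"
proof -
  have "\<exists>m. \<forall>u\<in>J. g u / f u = m"
  proof (rule has_field_derivative_zero_constant)
    show "convex J" using assms(1) by (simp add: is_interval_convex_1)
    fix u assume u: "u \<in> J"
    have "((\<lambda>u. g u / f u) has_real_derivative (g' u * f u - g u * f' u) / (f u * f u)) (at u)"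
      using assms(2,3,5) u by (intro DERIV_divide) auto
    then show "((\<lambda>u. g u / f u) has_real_derivative 0) (at u within J)"
      using assms(4)[OF u] by (simp add: mult.commute has_field_derivative_at_within)
  qed
  then show ?thesis using that assms(5) by (metis nonzero_eq_divide_eq)
qed

lemma vector_4_eq:
  "(vector [a, b, c, d] :: real^4) = a *\<^sub>R axis 1 1 + b *\<^sub>R axis 2 1 + c *\<^sub>R axis 3 1 + d *\<^sub>R axis 4 1"
  by (simp add: vec_eq_iff forall_4 axis_def)

lemma has_vector_derivative_vector_4:
  fixes a b c d :: "real \<Rightarrow> real"
  assumes "(a has_real_derivative a') F" "(b has_real_derivative b') F"
    "(c has_real_derivative c') F" "(d has_real_derivative d') F"
  shows "((\<lambda>t. vector [a t, b t, c t, d t] :: real^4) has_vector_derivative vector [a', b', c', d']) F"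
  unfolding vector_4_eq using assms
  by (intro has_vector_derivative_add
      bounded_linear.has_vector_derivative[OF bounded_linear_scaleR_left])
    (simp_all add: has_real_derivative_iff_has_vector_derivative)

lemma vector_derivative_cong_open:
  assumes "(g has_vector_derivative d) (at u)" "open J" "u \<in> J" "\<And>t. t \<in> J \<Longrightarrow> f t = g t"
  shows "vector_derivative f (at u) = d"
  using assms by (metis has_vector_derivative_transform_within_open vector_derivative_at)

section \<open>Rotational surfaces of elliptic type\<close>

text \<open>Up to second order every partial derivative of the surface is of one of two kinds: a
  \<open>radial\<close> vector, in the meridian hyperplane at angle \<open>v\<close>, or a
  \<open>circular\<close> one, tangent to the parallel.\<close>

definition radial :: "real \<Rightarrow> real \<Rightarrow> real \<Rightarrow> real \<Rightarrow> real^4" where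
  "radial v a b c = vector [a * cos v, a * sin v, b, c]"

definition circular :: "real \<Rightarrow> real \<Rightarrow> real^4" where
  "circular v s = vector [- (s * sin v), s * cos v, 0, 0]"

lemma mink_radial_circular [simp]:
  "mink (radial v a b c) (radial v a' b' c') = a * a' + b * b' - c * c'"
  "mink (radial v a b c) (circular v s) = 0"
  "mink (circular v s) (radial v a b c) = 0"
  "mink (circular v s) (circular v t) = s * t"
proof -
  show "mink (radial v a b c) (radial v a' b' c') = a * a' + b * b' - c * c'"
    using sin_cos_squared_add[of v] unfolding radial_def mink_def vector_4_nth by algebra
  show "mink (circular v s) (circular v t) = s * t"
    using sin_cos_squared_add[of v] unfolding circular_def mink_def vector_4_nth by algebra
qed (simp_all add: radial_def circular_def mink_def)

lemma circular_scaleR: "k *\<^sub>R circular v s = circular v (k * s)"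
  by (simp add: circular_def vec_eq_iff forall_4)

lemma radial_has_derivative_angle:
  "((\<lambda>v. radial v a b c) has_vector_derivative circular v a) (at v)"
  unfolding radial_def circular_def
  by (rule has_vector_derivative_vector_4) (auto intro!: derivative_eq_intros)

lemma circular_has_derivative_angle:
  "((\<lambda>v. circular v s) has_vector_derivative radial v (- s) 0 0) (at v)"
  unfolding radial_def circular_def
  by (rule has_vector_derivative_vector_4) (auto intro!: derivative_eq_intros)

lemma radial_has_derivative:
  assumes "(a has_real_derivative a') (at u)" "(b has_real_derivative b') (at u)"
    "(c has_real_derivative c') (at u)"
  shows "((\<lambda>u. radial v (a u) (b u) (c u)) has_vector_derivative radial v a' b' c') (at u)"
  unfolding radial_def
  by (rule has_vector_derivative_vector_4) (auto intro!: derivative_eq_intros assms)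

lemma circular_has_derivative:
  assumes "(s has_real_derivative s') (at u)"
  shows "((\<lambda>u. circular v (s u)) has_vector_derivative circular v s') (at u)"
  unfolding circular_def
  by (rule has_vector_derivative_vector_4) (auto intro!: derivative_eq_intros assms)

section \<open>Partial derivatives of the rotational surface\<close>

locale elliptic_rotational =
  fixes J :: "real set" and r x1 x2 :: "real \<Rightarrow> real"
  assumes open_J: "open J"
    and smooth: "smooth_fun_on J r" "smooth_fun_on J x1" "smooth_fun_on J x2"
    and arc_length: "\<And>u. u \<in> J \<Longrightarrow> (deriv r u)\<^sup>2 + (deriv x1 u)\<^sup>2 - (deriv x2 u)\<^sup>2 = 1"
    and r_pos: "\<And>u. u \<in> J \<Longrightarrow> r u > 0"
begin

abbreviation "M \<equiv> elliptic_rotational_surface r x1 x2"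
abbreviation "r' \<equiv> deriv r"
abbreviation "x1' \<equiv> deriv x1"
abbreviation "x2' \<equiv> deriv x2"
abbreviation "r'' \<equiv> deriv r'"
abbreviation "x1'' \<equiv> deriv x1'"
abbreviation "x2'' \<equiv> deriv x2'"

definition "q u = (r'' u)\<^sup>2 + (x1'' u)\<^sup>2 - (x2'' u)\<^sup>2"
definition "\<kappa>1 u = x1' u * x2'' u - x2' u * x1'' u"

lemma M_eq: "M u v = radial v (r u) (x1 u) (x2 u)"
  by (simp add: elliptic_rotational_surface_def radial_def)

lemmas smooth' = smooth[THEN smooth_fun_on_deriv]
lemmas smooth'' = smooth'[THEN smooth_fun_on_deriv]
lemmas smooth''' = smooth''[THEN smooth_fun_on_deriv]

context fixes u assumes u: "u \<in> J"
begin

text \<open>Derivatives up to order four are supplied, since \<kappa>1 already contains second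
  derivatives and is later differentiated twice.\<close>

lemmas derivs [derivative_intros] =
  smooth[THEN smooth_fun_on_has_derivative, OF open_J u]
  smooth'[THEN smooth_fun_on_has_derivative, OF open_J u]
  smooth''[THEN smooth_fun_on_has_derivative, OF open_J u]
  smooth'''[THEN smooth_fun_on_has_derivative, OF open_J u]

end

lemma partial_1: "u \<in> J \<Longrightarrow> partial 1 M u v = radial v (r' u) (x1' u) (x2' u)"
  by (auto simp: partial_def M_eq intro!: vector_derivative_at radial_has_derivative derivs)

lemma partial_2: "partial 2 M u v = circular v (r u)"
  by (simp add: partial_def M_eq vector_derivative_cong_open[OF radial_has_derivative_angle open_UNIV])

lemma partial_11: "u \<in> J \<Longrightarrow> partial 1 (partial 1 M) u v = radial v (r'' u) (x1'' u) (x2'' u)"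
  unfolding partial_def[of 1 "partial 1 M"]
  by (auto intro!: vector_derivative_cong_open[OF _ open_J] radial_has_derivative derivs partial_1)

lemma partial_12: "u \<in> J \<Longrightarrow> partial 1 (partial 2 M) u v = circular v (r' u)"
  by (auto simp: partial_def[of 1 "partial 2 M"] partial_2
      intro!: vector_derivative_at circular_has_derivative derivs)

lemma partial_21: "u \<in> J \<Longrightarrow> partial 2 (partial 1 M) u v = circular v (r' u)"
  by (simp add: partial_def[of 2 "partial 1 M"] partial_1
      vector_derivative_cong_open[OF radial_has_derivative_angle open_UNIV])

lemma partial_22: "partial 2 (partial 2 M) u v = radial v (- r u) 0 0"
  by (simp add: partial_def[of 2 "partial 2 M"] partial_2
      vector_derivative_cong_open[OF circular_has_derivative_angle open_UNIV])

lemma tangent_acceleration_orthogonal: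
  assumes "u \<in> J" shows "r' u * r'' u + x1' u * x1'' u - x2' u * x2'' u = 0"
proof -
  have "((\<lambda>u. (r' u)\<^sup>2 + (x1' u)\<^sup>2 - (x2' u)\<^sup>2) has_real_derivative
      2 * (r' u * r'' u + x1' u * x1'' u - x2' u * x2'' u)) (at u)"
    by (auto intro!: derivative_eq_intros derivs assms simp: algebra_simps)
  from has_derivative_const_on_open[OF this open_J assms arc_length] show ?thesis by simp
qed

text \<open>Lagrange's identity in the Lorentzian plane of \<open>x1\<close> and \<open>x2\<close>;
  the arc-length condition and its derivative then eliminate the inner products.\<close>

lemma kappa1_square:
  assumes "u \<in> J" shows "(\<kappa>1 u)\<^sup>2 = (r'' u)\<^sup>2 - q u * (1 - (r' u)\<^sup>2)"
proof -
  have "(\<kappa>1 u)\<^sup>2 = (x1' u * x1'' u - x2' u * x2'' u)\<^sup>2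
      - ((x1' u)\<^sup>2 - (x2' u)\<^sup>2) * ((x1'' u)\<^sup>2 - (x2'' u)\<^sup>2)"
    unfolding \<kappa>1_def by algebra
  also have "x1' u * x1'' u - x2' u * x2'' u = - (r' u * r'' u)"
    using tangent_acceleration_orthogonal[OF assms] by simp
  also have "(x1' u)\<^sup>2 - (x2' u)\<^sup>2 = 1 - (r' u)\<^sup>2"
    using arc_length[OF assms] by simp
  finally show ?thesis unfolding q_def by algebra
qed

lemma orthogonal_conjugate: "u \<in> J \<Longrightarrow> orthogonal_conjugate M u v"
proof
  assume u: "u \<in> J"
  \<comment> \<open>\<open>partial 2 M\<close> is \<open>circular v (r u)\<close>, so
    \<open>k / r u\<close> is the coefficient that rescales it to
    \<open>circular v k\<close>.\<close>
  have Q: "tangent M u v (axis 2 (k / r u)) = circular v k" for k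
    using r_pos[OF u] by (simp add: tangent_def sum_2 axis_def partial_2 circular_scaleR)
  have "circular v k \<in> tangent_space M u v" for k
    unfolding tangent_space_def Q[symmetric] by (rule rangeI)
  then show "partial 1 (partial 2 M) u v \<in> tangent_space M u v"
    "partial 2 (partial 1 M) u v \<in> tangent_space M u v"
    using u by (simp_all add: partial_12 partial_21)
  show "0 < mink (partial 1 M u v) (partial 1 M u v)"
    using u arc_length[OF u] by (simp add: partial_1 power2_eq_square)
  show "0 < mink (partial 2 M u v) (partial 2 M u v)"
    "mink (partial 1 M u v) (partial 2 M u v) = 0"
    using u r_pos[OF u] by (simp_all add: partial_1 partial_2)
qed

section \<open>Inner products of the normal vectors and the pointwise Chen condition\<close>

context
  fixes u v :: real assumes u: "u \<in> J"
begin

interpretation orthogonal_conjugate M u v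
  using u by (rule orthogonal_conjugate)

lemma mink_P_P: "mink P P = 1"
  using arc_length[OF u] by (simp add: partial_1 u power2_eq_square)

text \<open>The acceleration is already normal: it is orthogonal to the unit tangent of the
  meridian, and radial vectors are orthogonal to circular ones.\<close>

lemma L_eq: "L = partial 1 (partial 1 M) u v"
  using tangent_acceleration_orthogonal[OF u] unfolding L_def mink_P_P normal_part_eq
  by (simp add: partial_1 partial_2 partial_11 u mult.commute)

lemma K_eq: "K = (1 / (r u)\<^sup>2) *\<^sub>R (radial v (- r u) 0 0 + (r u * r' u) *\<^sub>R P)"
  unfolding K_def normal_part_eq mink_P_P
  by (simp add: partial_1 partial_2 partial_22 u power2_eq_square)

lemma mink_L_L: "mink L L = q u"
  by (simp add: L_eq partial_11 u q_def power2_eq_square)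

lemma mink_L_K: "mink L K = - r'' u / r u"
  using L_K_normal r_pos[OF u]
  by (simp add: K_eq) (simp add: L_eq partial_11 u power2_eq_square)

text \<open>The radial term has square \<open>(r u)\<^sup>2\<close>; the correction by
  \<open>P\<close> subtracts the square of its tangential part.\<close>

lemma mink_K_K: "mink K K = (1 - (r' u)\<^sup>2) / (r u)\<^sup>2"
proof -
  have "mink (radial v (- r u) 0 0) P = - r u * r' u" "mink P (radial v (- r u) 0 0) = - r u * r' u"
    by (simp_all add: partial_1 u)
  then show ?thesis using r_pos[OF u] mink_P_P
    by (simp add: K_eq field_simps power2_eq_square)
qed

lemma gram_eq: "gram = - (\<kappa>1 u)\<^sup>2 / (r u)\<^sup>2"
  using r_pos[OF u]
  by (simp add: gram_def mink_L_L mink_L_K mink_K_K kappa1_square[OF u] power_divide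
      field_simps)

lemma Chen_at_iff:
  assumes "q u \<noteq> 0"
  shows "(let H = mean_curvature M u v in H = 0 \<or> (mink H H \<noteq> 0 \<and> allied M u v H = 0))
     \<longleftrightarrow> \<kappa>1 u = 0 \<or> (r u)\<^sup>2 * (q u)\<^sup>2 - (r'' u)\<^sup>2 + (\<kappa>1 u)\<^sup>2 = 0"
proof -
  have "gram = 0 \<longleftrightarrow> \<kappa>1 u = 0" using r_pos[OF u] by (auto simp: gram_eq)
  \<comment> \<open>The expression of case (iii) is \<open>q u\<close> times the cleared difference
    of the squares of \<open>L\<close> and \<open>K\<close>, and \<open>q u\<close> is
    nonzero.\<close>
  moreover have "(r u)\<^sup>2 * (q u)\<^sup>2 - (r'' u)\<^sup>2 + (\<kappa>1 u)\<^sup>2 = q u * ((r u)\<^sup>2 * q u - (1 - (r' u)\<^sup>2))"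
    unfolding kappa1_square[OF u] by (simp add: algebra_simps power2_eq_square)
  moreover have "mink L L = mink K K \<longleftrightarrow> (r u)\<^sup>2 * q u - (1 - (r' u)\<^sup>2) = 0"
    using r_pos[OF u] by (simp add: mink_L_L mink_K_K eq_divide_eq mult.commute)
  ultimately show ?thesis
    unfolding Let_def using Chen_condition_iff[OF _ refl] assms mink_L_L by (simp add: assms)
qed

lemma mean_curvature_0:
  assumes "q u \<noteq> 0" "\<kappa>1 u = 0" "r u * q u = r'' u"
  shows "mean_curvature M u v = 0"
proof (rule mean_curvature_eq_0)
  show "mink L K = - mink L L"
    using r_pos[OF u] by (simp add: mink_L_K mink_L_L assms(3)[symmetric])
qed (use assms in \<open>simp_all add: mink_L_L gram_eq\<close>)

lemma mean_curvature_nonzero: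
  assumes "\<kappa>1 u \<noteq> 0" shows "mean_curvature M u v \<noteq> 0"
  using mean_curvature_eq_0_imp_gram assms r_pos[OF u] by (auto simp: gram_eq)

end

lemma curve_tangent'_meridian:
  assumes "u \<in> J"
  shows "curve_tangent' (meridian r x1 x2) u = radial 0 (r'' u) (x1'' u) (x2'' u)"
proof -
  have "meridian r x1 x2 = (\<lambda>t. radial 0 (r t) (x1 t) (x2 t))"
    by (simp add: meridian_def radial_def fun_eq_iff)
  then have tangent: "curve_tangent (meridian r x1 x2) t = radial 0 (r' t) (x1' t) (x2' t)" if "t \<in> J" for t
    using that by (auto simp: curve_tangent_def intro!: vector_derivative_at radial_has_derivative derivs)
  show ?thesis
    unfolding curve_tangent'_def
    by (rule vector_derivative_cong_open[OF radial_has_derivative open_J])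
      (use assms tangent in \<open>auto intro: derivs\<close>)
qed

text \<open>Translates the curve invariants into the signed quantity \<open>q\<close>, in which the
  surface computations are phrased.\<close>

lemma curvature_sign:
  fixes c defines "c \<equiv> meridian r x1 x2"
  assumes "u \<in> J" "q u \<noteq> 0"
  shows "(curvature c u)\<^sup>2 = \<bar>q u\<bar>"
    "mink (principal_normal c u) (principal_normal c u) = sgn (q u)"
proof -
  have "mink (curve_tangent' c u) (curve_tangent' c u) = q u"
    unfolding c_def curve_tangent'_meridian[OF assms(2)] by (simp add: q_def power2_eq_square)
  moreover from this show "(curvature c u)\<^sup>2 = \<bar>q u\<bar>" by (simp add: curvature_def)
  ultimately show "mink (principal_normal c u) (principal_normal c u) = sgn (q u)"
    by (simp add: principal_normal_def sgn_if flip: power2_eq_square mult.assoc)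
qed

section \<open>Rotational surfaces in a hyperplane\<close>

text \<open>A full parallel circle forces the hyperplane normal to have zero first two components.
  Differentiating the remaining relation twice gives a nontrivial solution of a linear system with
  determinant \<kappa>1.\<close>

lemma hyperplane_imp_kappa1_0:
  assumes "lies_in_hyperplane M (J \<times> {0..<2 * pi})" "u \<in> J"
  shows "\<kappa>1 u = 0"
proof -
  obtain S where S: "affine S" "aff_dim S = 3" "\<And>u v. u \<in> J \<Longrightarrow> 0 \<le> v \<Longrightarrow> v < 2 * pi \<Longrightarrow> M u v \<in> S"
    using assms(1) by (auto simp: lies_in_hyperplane_def)
  then have "aff_dim S = DIM(real^4) - 1" by simp
  then obtain a b where a: "a \<noteq> 0" and "affine hull S = {x. a \<bullet> x = b}"
    unfolding aff_dim_eq_hyperplane by blast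
  then have "S = {x. a \<bullet> x = b}" using S(1) hull_same[of affine S] by simp
  then have plane: "a$1 * (r t * cos v) + a$2 * (r t * sin v) + a$3 * x1 t + a$4 * x2 t = b"
    if "t \<in> J" "0 \<le> v" "v < 2 * pi" for t v
    using S(3)[OF that] by (simp add: M_eq radial_def inner_vec_def sum_4)
  define w where "w = a$3 * x1 u + a$4 * x2 u"
  \<comment> \<open>The angles 0, \<open>pi\<close> and \<open>pi/2\<close> suffice to isolate
    \<open>a$1\<close> and \<open>a$2\<close>.\<close>
  have "a$1 * r u + w = b" "w - a$1 * r u = b" "a$2 * r u + w = b"
    using plane[OF assms(2), of 0] plane[OF assms(2), of pi] plane[OF assms(2), of "pi/2"]
    by (simp_all add: w_def)
  then have "a$1 * r u = 0" "a$2 * r u = 0" by linarith+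
  then have a1: "a$1 = 0" and a2: "a$2 = 0" using r_pos[OF assms(2)] by simp_all
  have const: "a$3 * x1 t + a$4 * x2 t = b" if "t \<in> J" for t
    using plane[OF that, of 0] by (simp add: a1 a2)
  have d1: "a$3 * x1' t + a$4 * x2' t = 0" if "t \<in> J" for t
  proof (rule has_derivative_const_on_open[OF _ open_J that const])
    show "((\<lambda>t. a$3 * x1 t + a$4 * x2 t) has_real_derivative a$3 * x1' t + a$4 * x2' t) (at t)"
      by (auto intro!: derivative_eq_intros derivs that)
  qed
  have d2: "a$3 * x1'' u + a$4 * x2'' u = 0"
  proof (rule has_derivative_const_on_open[OF _ open_J assms(2) d1])
    show "((\<lambda>t. a$3 * x1' t + a$4 * x2' t) has_real_derivative a$3 * x1'' u + a$4 * x2'' u) (at u)"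
      by (auto intro!: derivative_eq_intros derivs assms)
  qed
  have "a$3 * \<kappa>1 u = 0" "a$4 * \<kappa>1 u = 0"
    using d1[OF assms(2)] d2 unfolding \<kappa>1_def by algebra+
  moreover have "a$3 \<noteq> 0 \<or> a$4 \<noteq> 0"
    using a a1 a2 by (auto simp: vec_eq_iff forall_4)
  ultimately show ?thesis by auto
qed

lemma hyperplaneI:
  assumes "\<alpha> \<noteq> 0 \<or> \<beta> \<noteq> 0" "\<And>u. u \<in> J \<Longrightarrow> \<alpha> * x1 u + \<beta> * x2 u = k"
  shows "lies_in_hyperplane M (J \<times> V)"
proof -
  let ?a = "vector [0, 0, \<alpha>, \<beta>] :: real^4"
  have "?a \<noteq> 0" using assms(1) by (auto simp: vec_eq_iff forall_4)
  then have "affine {x. ?a \<bullet> x = k}" "aff_dim {x. ?a \<bullet> x = k} = 3"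
    by (simp_all add: affine_hyperplane)
  moreover have "M u v \<in> {x. ?a \<bullet> x = k}" if "u \<in> J" for u v
    using assms(2)[OF that] by (simp add: M_eq radial_def inner_vec_def sum_4)
  ultimately show ?thesis unfolding lies_in_hyperplane_def by blast
qed

text \<open>
  The direction of \<open>(x1', x2')\<close> need not be defined everywhere, since this vector may vanish.
  The field \<open>(p1, p2) = r' (x1'', x2'') - r'' (x1', x2')\<close> is parallel to it and, when
  \<open>\<kappa>1 = 0\<close>, has Minkowski square \<open>q\<close>, so it vanishes nowhere; its direction is constant.
\<close>

definition "p1 u = r' u * x1'' u - r'' u * x1' u"
definition "p2 u = r' u * x2'' u - r'' u * x2' u"

context
  assumes interval: "is_interval J" and q: "\<And>u. u \<in> J \<Longrightarrow> q u \<noteq> 0"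
    and \<kappa>1_0: "\<And>u. u \<in> J \<Longrightarrow> \<kappa>1 u = 0"
begin

lemma p_square: "u \<in> J \<Longrightarrow> (p1 u)\<^sup>2 - (p2 u)\<^sup>2 = q u"
proof -
  assume u: "u \<in> J"
  have "(p1 u)\<^sup>2 - (p2 u)\<^sup>2 = (r' u)\<^sup>2 * ((x1'' u)\<^sup>2 - (x2'' u)\<^sup>2)
      - 2 * (r' u * r'' u) * (x1' u * x1'' u - x2' u * x2'' u)
      + (r'' u)\<^sup>2 * ((x1' u)\<^sup>2 - (x2' u)\<^sup>2)"
    unfolding p1_def p2_def by algebra
  also have "x1' u * x1'' u - x2' u * x2'' u = - (r' u * r'' u)"
    using tangent_acceleration_orthogonal[OF u] by simp
  also have "(x1' u)\<^sup>2 - (x2' u)\<^sup>2 = 1 - (r' u)\<^sup>2"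
    using arc_length[OF u] by simp
  also have "(x1'' u)\<^sup>2 - (x2'' u)\<^sup>2 = q u - (r'' u)\<^sup>2" by (simp add: q_def)
  \<comment> \<open>Here the vanishing of \<kappa>1 enters.\<close>
  also have "(r'' u)\<^sup>2 = q u * (1 - (r' u)\<^sup>2)"
    using kappa1_square[OF u] \<kappa>1_0[OF u] by simp
  finally show ?thesis using \<open>(r'' u)\<^sup>2 = q u * (1 - (r' u)\<^sup>2)\<close> by algebra
qed

text \<open>The determinant of \<open>(x1', x2')\<close> and \<open>(p1, p2)\<close> is
  \<open>r' u\<close> times \<kappa>1.\<close>

lemma x_parallel_p: "u \<in> J \<Longrightarrow> x1' u * p2 u = x2' u * p1 u"
  using \<kappa>1_0[of u] unfolding p1_def p2_def \<kappa>1_def by algebra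

text \<open>The derivatives of \<open>p1\<close> and \<open>p2\<close>, after the products of two
  second derivatives have cancelled.\<close>

definition "p1' u = r' u * deriv x1'' u - deriv r'' u * x1' u"
definition "p2' u = r' u * deriv x2'' u - deriv r'' u * x2' u"

lemma p_has_derivative:
  assumes "u \<in> J"
  shows "(p1 has_real_derivative p1' u) (at u)" "(p2 has_real_derivative p2' u) (at u)"
  unfolding p1_def[abs_def] p2_def[abs_def] p1'_def p2'_def
  by (auto intro!: derivative_eq_intros derivs assms)

text \<open>Write x for the pair \<open>(x1, x2)\<close>. The determinant of p and p' expands into
  the determinants of x', x'', x''' taken in pairs. Those involving x' are \<kappa>1 and its
  derivative; the one of x'' and x''' needs a separate argument.\<close>

lemma p_parallel_derivative:
  assumes u: "u \<in> J"
  shows "p1 u * p2' u = p2 u * p1' u"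
proof -
  have \<kappa>1': "x1' t * deriv x2'' t - x2' t * deriv x1'' t = 0" if t: "t \<in> J" for t
  proof (rule has_derivative_const_on_open[OF _ open_J t \<kappa>1_0])
    show "(\<kappa>1 has_real_derivative x1' t * deriv x2'' t - x2' t * deriv x1'' t) (at t)"
      unfolding \<kappa>1_def[abs_def] by (auto intro!: derivative_eq_intros derivs t)
  qed
  let ?D = "\<lambda>t. x1' t * deriv x2'' t - x2' t * deriv x1'' t"
  have "(x1'' u * deriv x2'' u + x1' u * deriv (deriv x2'') u)
      - (x2'' u * deriv x1'' u + x2' u * deriv (deriv x1'') u) = 0" (is "?E = 0")
  proof (rule has_derivative_const_on_open[OF _ open_J u \<kappa>1'])
    show "(?D has_real_derivative ?E) (at u)"
      by (auto intro!: derivative_eq_intros derivs u)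
  qed
  \<comment> \<open>Where x' vanishes, the second derivative of \<kappa>1 reduces to the determinant
    of x'' and x'''.\<close>
  then have at_zero: "x1'' u * deriv x2'' u - x2'' u * deriv x1'' u = 0"
    if "x1' u = 0" "x2' u = 0" using that by simp
  \<comment> \<open>Where x' is nonzero, both x'' and x''' are parallel to it.\<close>
  have "x1' u * (x1'' u * deriv x2'' u - x2'' u * deriv x1'' u) = 0"
    "x2' u * (x1'' u * deriv x2'' u - x2'' u * deriv x1'' u) = 0"
    using \<kappa>1'[OF u] \<kappa>1_0[OF u] unfolding \<kappa>1_def by algebra+
  then have "x1'' u * deriv x2'' u - x2'' u * deriv x1'' u = 0"
    using at_zero by fastforce
  then show ?thesis
    using \<kappa>1'[OF u] \<kappa>1_0[OF u] unfolding p1_def p2_def p1'_def p2'_def \<kappa>1_def by algebra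
qed

lemma linear_combination_constant:
  assumes "\<And>u. u \<in> J \<Longrightarrow> \<alpha> * x1' u + \<beta> * x2' u = 0"
  shows "\<exists>k. \<forall>u\<in>J. \<alpha> * x1 u + \<beta> * x2 u = k"
proof (rule has_field_derivative_zero_constant)
  show "convex J" using interval by (simp add: is_interval_convex_1)
  fix u assume u: "u \<in> J"
  have "((\<lambda>u. \<alpha> * x1 u + \<beta> * x2 u) has_real_derivative \<alpha> * x1' u + \<beta> * x2' u) (at u)"
    by (auto intro!: derivative_eq_intros derivs u)
  then show "((\<lambda>u. \<alpha> * x1 u + \<beta> * x2 u) has_real_derivative 0) (at u within J)"
    using assms[OF u] by (simp add: has_field_derivative_at_within)
qed

text \<open>A continuous function without zeros keeps its sign on an interval. By
  \<open>p_square\<close> this sign decides which of \<open>p1\<close> and \<open>p2\<close> never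
  vanishes.\<close>

lemma q_constant_sign: "(\<forall>u\<in>J. q u > 0) \<or> (\<forall>u\<in>J. q u < 0)"
proof -
  have "connected (q ` J)"
  proof (rule connected_continuous_image)
    show "continuous_on J q"
      unfolding q_def by (intro continuous_intros DERIV_continuous_on[of J])
        (auto intro: derivs has_field_derivative_at_within)
    show "connected J" using interval by (simp add: is_interval_connected_1)
  qed
  then have "is_interval (q ` J)" by (simp add: is_interval_connected_1)
  then show ?thesis
    using q unfolding is_interval_1 by (smt (verit, best) imageE imageI)
qed

text \<open>Dividing by the component of p that has no zero gives a constant slope. As x' is
  parallel to p, one fixed linear combination of \<open>x1\<close> and \<open>x2\<close> has zero
  derivative.\<close>

lemma kappa1_0_imp_hyperplane: "lies_in_hyperplane M (J \<times> V)"
proof -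
  have "\<exists>\<alpha> \<beta>. (\<alpha> \<noteq> 0 \<or> \<beta> \<noteq> 0) \<and> (\<forall>u\<in>J. \<alpha> * x1' u + \<beta> * x2' u = 0)"
    using q_constant_sign
  proof
    assume "\<forall>u\<in>J. q u > 0"
    then have p1: "p1 u \<noteq> 0" if "u \<in> J" for u
      using p_square[OF that] that
      by (metis diff_0 neg_0_less_iff_less not_less zero_eq_power2 zero_le_power2)
    obtain m where m: "\<And>u. u \<in> J \<Longrightarrow> p2 u = m * p1 u"
      by (rule ratio_constant[OF interval, of p1 p1' p2 p2'])
        (simp_all add: p_has_derivative p_parallel_derivative p1)
    have "(- m) * x1' u + 1 * x2' u = 0" if "u \<in> J" for u
      using x_parallel_p[OF that] m[OF that] p1[OF that] by (simp add: mult.commute)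
    then show ?thesis by (metis zero_neq_one)
  next
    assume "\<forall>u\<in>J. q u < 0"
    then have p2: "p2 u \<noteq> 0" if "u \<in> J" for u
      using p_square[OF that] that by (metis diff_zero not_less zero_eq_power2 zero_le_power2)
    obtain m where m: "\<And>u. u \<in> J \<Longrightarrow> p1 u = m * p2 u"
      by (rule ratio_constant[OF interval, of p2 p2' p1 p1'])
        (simp_all add: p_has_derivative p_parallel_derivative p2)
    have "1 * x1' u + (- m) * x2' u = 0" if "u \<in> J" for u
      using x_parallel_p[OF that] m[OF that] p2[OF that] by (simp add: mult.commute)
    then show ?thesis by (metis zero_neq_one)
  qed
  then obtain \<alpha> \<beta> where "\<alpha> \<noteq> 0 \<or> \<beta> \<noteq> 0" "\<And>u. u \<in> J \<Longrightarrow> \<alpha> * x1' u + \<beta> * x2' u = 0"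
    by blast
  moreover from linear_combination_constant[OF this(2)]
  obtain k where "\<And>u. u \<in> J \<Longrightarrow> \<alpha> * x1 u + \<beta> * x2 u = k" by blast
  ultimately show ?thesis by (intro hyperplaneI)
qed

end

end

section \<open>Chen rotational surfaces of elliptic type\<close>

theorem proposition2p2:
  fixes J :: "real set" and r x1 x2 :: "real \<Rightarrow> real"
  defines "c \<equiv> meridian r x1 x2"
  defines "\<kappa> \<equiv> curvature c"
  defines "\<epsilon> \<equiv> (\<lambda>u. mink (principal_normal c u) (principal_normal c u))"
  defines "\<kappa>1 \<equiv> (\<lambda>u. deriv x1 u * deriv (deriv x2) u - deriv x2 u * deriv (deriv x1) u)"
  defines "M \<equiv> elliptic_rotational_surface r x1 x2"
  defines "D \<equiv> J \<times> {0..<2 * pi}"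
  assumes J: "open J" "is_interval J" "J \<noteq> {}"
    and smooth: "smooth_fun_on J r" "smooth_fun_on J x1" "smooth_fun_on J x2"
    and arc_length: "\<And>u. u \<in> J \<Longrightarrow> (deriv r u)\<^sup>2 + (deriv x1 u)\<^sup>2 - (deriv x2 u)\<^sup>2 = 1"
    and r_pos: "\<And>u. u \<in> J \<Longrightarrow> r u > 0"
    and non_null: "\<And>u. u \<in> J \<Longrightarrow>
      (deriv (deriv r) u)\<^sup>2 + (deriv (deriv x1) u)\<^sup>2 - (deriv (deriv x2) u)\<^sup>2 \<noteq> 0"
  shows "(Chen_surface M D \<longleftrightarrow>
           (\<forall>u\<in>J. (\<kappa>1 u = 0 \<and> r u * (\<kappa> u)\<^sup>2 - \<epsilon> u * deriv (deriv r) u = 0)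
                \<or> (\<kappa>1 u = 0 \<and> r u * (\<kappa> u)\<^sup>2 - \<epsilon> u * deriv (deriv r) u \<noteq> 0)
                \<or> (\<kappa>1 u \<noteq> 0 \<and> (r u)\<^sup>2 * (\<kappa> u)^4 - (deriv (deriv r) u)\<^sup>2 + (\<kappa>1 u)\<^sup>2 = 0)))
       \<and> ((\<forall>u\<in>J. \<kappa>1 u = 0) \<and> (\<forall>u\<in>J. r u * (\<kappa> u)\<^sup>2 - \<epsilon> u * deriv (deriv r) u = 0)
            \<longrightarrow> minimal_surface M D \<and> trivial_Chen_surface M D)
       \<and> ((\<forall>u\<in>J. \<kappa>1 u = 0) \<and> (\<exists>u\<in>J. r u * (\<kappa> u)\<^sup>2 - \<epsilon> u * deriv (deriv r) u \<noteq> 0)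
            \<longrightarrow> lies_in_hyperplane M D \<and> trivial_Chen_surface M D)
       \<and> ((\<exists>u\<in>J. \<kappa>1 u \<noteq> 0)
            \<and> (\<forall>u\<in>J. (r u)\<^sup>2 * (\<kappa> u)^4 - (deriv (deriv r) u)\<^sup>2 + (\<kappa>1 u)\<^sup>2 = 0)
            \<longrightarrow> Chen_surface M D \<and> \<not> minimal_surface M D \<and> \<not> lies_in_hyperplane M D)"
proof -
  interpret S: elliptic_rotational J r x1 x2
    using J smooth arc_length r_pos by unfold_locales
  have q: "S.q u \<noteq> 0" if "u \<in> J" for u using non_null[OF that] by (simp add: S.q_def)
  have \<kappa>1: "\<kappa>1 = S.\<kappa>1" by (simp add: \<kappa>1_def S.\<kappa>1_def fun_eq_iff)
  have \<kappa>2: "(\<kappa> u)\<^sup>2 = \<bar>S.q u\<bar>" and \<epsilon>: "\<epsilon> u = sgn (S.q u)" if "u \<in> J" for u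
    using S.curvature_sign[OF that q[OF that]] by (simp_all add: \<kappa>_def \<epsilon>_def c_def)
  have \<kappa>4: "(\<kappa> u)^4 = (S.q u)\<^sup>2" if "u \<in> J" for u
    using \<kappa>2[OF that] power_mult[of "\<kappa> u" 2 2] by simp
  \<comment> \<open>Cases (i) and (ii) together amount to \<kappa>1 = 0 at the point, so two
    alternatives are left.\<close>
  have Chen: "Chen_surface M D \<longleftrightarrow> (\<forall>u\<in>J. \<kappa>1 u = 0
      \<or> (r u)\<^sup>2 * (\<kappa> u)^4 - (deriv (deriv r) u)\<^sup>2 + (\<kappa>1 u)\<^sup>2 = 0)"
  proof -
    have "Chen_surface M D \<longleftrightarrow> (\<forall>u\<in>J. \<forall>v\<in>{0..<2 * pi}. \<kappa>1 u = 0
      \<or> (r u)\<^sup>2 * (\<kappa> u)^4 - (deriv (deriv r) u)\<^sup>2 + (\<kappa>1 u)\<^sup>2 = 0)"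
      unfolding Chen_surface_def D_def M_def
      by (auto simp: S.Chen_at_iff q \<kappa>1 \<kappa>4)
    \<comment> \<open>The condition does not depend on \<open>v\<close>, so a nonempty range of
      angles removes that quantifier.\<close>
    moreover have "0 \<in> {0..<2 * pi}" by simp
    ultimately show ?thesis by blast
  qed
  have minimal: "minimal_surface M D"
    if "\<forall>u\<in>J. \<kappa>1 u = 0" "\<forall>u\<in>J. r u * (\<kappa> u)\<^sup>2 - \<epsilon> u * deriv (deriv r) u = 0"
  proof -
    have "r u * S.q u = deriv (deriv r) u" if u: "u \<in> J" for u
    proof -
      \<comment> \<open>Both \<kappa> squared, which is the absolute value of \<open>S.q u\<close>,
        and \<epsilon> contain the factor \<open>sgn (S.q u)\<close>.\<close>
      have "sgn (S.q u) * (r u * S.q u - deriv (deriv r) u) = 0"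
        using \<open>\<forall>u\<in>J. r u * (\<kappa> u)\<^sup>2 - \<epsilon> u * deriv (deriv r) u = 0\<close>[rule_format, OF u]
        by (simp add: \<kappa>2 \<epsilon> u abs_sgn algebra_simps)
      then show ?thesis using q[OF u] by (simp add: sgn_0_0)
    qed
    then show ?thesis
      using that(1) q by (auto simp: minimal_surface_def D_def M_def \<kappa>1 S.mean_curvature_0)
  qed
  have "lies_in_hyperplane M D" if "\<forall>u\<in>J. \<kappa>1 u = 0"
    unfolding D_def M_def using that \<kappa>1 by (intro S.kappa1_0_imp_hyperplane J q) auto
  moreover have "\<not> minimal_surface M D" "\<not> lies_in_hyperplane M D" if "\<exists>u\<in>J. \<kappa>1 u \<noteq> 0"
  proof -
    \<comment> \<open>One parameter with nonzero \<kappa>1 contradicts both minimality and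
      containment in a hyperplane.\<close>
    from that obtain u where u: "u \<in> J" "S.\<kappa>1 u \<noteq> 0" by (auto simp: \<kappa>1)
    then have "(u, 0) \<in> D" by (simp add: D_def)
    then show "\<not> minimal_surface M D"
      using S.mean_curvature_nonzero[OF u] unfolding minimal_surface_def M_def by blast
    show "\<not> lies_in_hyperplane M D"
      using S.hyperplane_imp_kappa1_0 u unfolding M_def D_def by blast
  qed
  ultimately show ?thesis
    using minimal Chen unfolding trivial_Chen_surface_def by blast
qed

end
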